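(* Let $m$ be a positive integer and $u=m(m-1)\cdots 1$. A finite word $w$ over the positive integers satisfies $uw\equiv wu$ if and only if the rows $R_1,R_2,\ldots$ of $P=P(w)$ satisfy: every entry of $R_i$ is at most $m$ for all $1\le i\le m$.
   Context: $P(v)$ is the RSK insertion tableau of $v$ (row $R_1$ on top; rows beyond the last are empty) and $\equiv$ is Knuth equivalence ($v\equiv w$ iff $P(v)=P(w)$). *)

theory Defs
  imports Main
begin

text \<open>Words are lists of natural numbers; that the letters are positive is a hypothesis of
  the theorem. A tableau is the list of its rows, top row first, each row read left to right;
  in a semistandard tableau rows weakly increase and columns strictly increase downwards.\<close>

text \<open>Inserting a letter into a row replaces the leftmost strictly larger entry, which is
  returned as the bumped letter; if no entry is strictly larger, the letter is appended
  and nothing is bumped.\<close>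

fun row_insert :: "nat \<Rightarrow> nat list \<Rightarrow> nat list \<times> nat option" where
  "row_insert x [] = ([x], None)"
| "row_insert x (y # ys) =
     (if x < y then (x # ys, Some y)
      else (case row_insert x ys of (zs, b) \<Rightarrow> (y # zs, b)))"

fun tableau_insert :: "nat \<Rightarrow> nat list list \<Rightarrow> nat list list" where
  "tableau_insert x [] = [[x]]"
| "tableau_insert x (r # rs) =
     (case row_insert x r of
        (r', None) \<Rightarrow> r' # rs
      | (r', Some y) \<Rightarrow> r' # tableau_insert y rs)"

text \<open>The letters of the word are inserted from left to right.\<close>

definition insertion_tableau :: "nat list \<Rightarrow> nat list list" where
  "insertion_tableau w = fold tableau_insert w []"

text \<open>Rows are numbered from 1; rows beyond the last one are empty.\<close>

definition tableau_row :: "nat list list \<Rightarrow> nat \<Rightarrow> nat list" where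
  "tableau_row T i = (if 1 \<le> i \<and> i \<le> length T then T ! (i - 1) else [])"

text \<open>Two words are Knuth equivalent iff their insertion tableaux coincide. By a theorem of
  Knuth this is the congruence generated by the elementary Knuth relations.\<close>

definition knuth_equiv :: "nat list \<Rightarrow> nat list \<Rightarrow> bool"  (infix "\<equiv>\<^sub>K" 50) where
  "v \<equiv>\<^sub>K w \<longleftrightarrow> insertion_tableau v = insertion_tableau w"

text \<open>The word m (m - 1) ... 1.\<close>

definition decreasing_word :: "nat \<Rightarrow> nat list" where
  "decreasing_word m = rev [1..<Suc m]"

end

theory Submission
  imports Defs
begin

text \<open>Every entry of row \<open>i\<close> of an insertion tableau is at least \<open>i\<close>. Hence a column
  \<open>1, \<dots>, m\<close> placed to the left of a tableau never takes part in a bump, and the tableau of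
  \<open>u w\<close> is always \<open>P(w)\<close> with \<open>i\<close> prepended to row \<open>i\<close> for \<open>i \<le> m\<close>. On the other hand, the
  letters \<open>m, \<dots>, i\<close> inserted into row \<open>i\<close> of \<open>P(w)\<close> lengthen that row only if
  its entries are at most \<open>m\<close>; in that case they prepend \<open>i\<close> to it and bump \<open>m, \<dots>, i + 1\<close>
  into the next row.\<close>

lemma row_insert_sorted:
  assumes "row_insert x r = (r', b)" "sorted r"
  shows "sorted r' \<and> set r' \<subseteq> insert x (set r)"
  using assms
proof (induction r arbitrary: r' b)
  case (Cons y ys)
  show ?case
  proof (cases "x < y")
    case True
    with Cons.prems show ?thesis by fastforce
  next
    case False
    with Cons.prems obtain zs where zs: "row_insert x ys = (zs, b)" "r' = y # zs"
      by (auto split: prod.splits)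
    with Cons.IH[OF zs(1)] Cons.prems(2) False show ?thesis by auto
  qed
qed auto

lemma row_insert_bumped_gt: "row_insert x r = (r', Some y) \<Longrightarrow> x < y"
  by (induction r arbitrary: r') (auto split: if_splits prod.splits)

lemma row_insert_bumping:
  assumes "\<exists>y\<in>set r. x < y"
  obtains r' z where "row_insert x r = (r', Some z)" "length r' = length r" "x \<in> set r'"
proof -
  have "\<exists>r' z. row_insert x r = (r', Some z) \<and> length r' = length r \<and> x \<in> set r'"
    using assms by (induction r) fastforce+
  with that show thesis by blast
qed

lemma insort_Cons: "\<forall>y\<in>set r. (x :: nat) \<le> y \<Longrightarrow> insort x r = x # r"
  by (cases r) auto

text \<open>In the sorted row the leftmost entry exceeding \<open>k\<close> is a copy of
  \<open>Suc k\<close>, and lowering it to \<open>k\<close> keeps the row sorted.\<close>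

lemma row_insert_pred_insort:
  "sorted r \<Longrightarrow> row_insert k (insort (Suc k) r) = (insort k r, Some (Suc k))"
  by (induction r) (auto simp: insort_Cons not_less_eq_eq dest: le_antisym)

text \<open>The second component collects the bumped letters in order: it is the word that the next
  row receives.\<close>

fun row_inserts :: "nat list \<Rightarrow> nat list \<Rightarrow> nat list \<times> nat list" where
  "row_inserts [] r = (r, [])"
| "row_inserts (x # xs) r =
     (case row_insert x r of
        (r', None) \<Rightarrow> row_inserts xs r'
      | (r', Some y) \<Rightarrow> (case row_inserts xs r' of (r'', ys) \<Rightarrow> (r'', y # ys)))"

text \<open>Lower rows never influence higher ones, so the whole word may pass through the top row
  before the rest is touched.\<close>

lemma fold_tableau_insert_Cons:
  "row_inserts xs r = (r', ys) \<Longrightarrow>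
    fold tableau_insert xs (r # rs) = r' # fold tableau_insert ys rs"
  by (induction xs arbitrary: r rs ys) (auto split: prod.splits option.splits)

text \<open>Each letter bumps its successor, so the extra entry descends step by step from
  \<open>k\<close> to \<open>i\<close>.\<close>

lemma row_inserts_decreasing_insort:
  assumes "sorted r" "i \<le> k"
  shows "row_inserts (rev [i..<k]) (insort k r) = (insort i r, rev [Suc i..<Suc k])"
  using assms(2)
proof (induction k rule: dec_induct)
  case (step k)
  with row_insert_pred_insort[OF assms(1), of k] show ?case by simp
qed simp

lemma row_inserts_decreasing_bounded:
  assumes "sorted r" "\<forall>x\<in>set r. i \<le> x \<and> x < k" "i < k"
  shows "row_inserts (rev [i..<k]) r = (i # r, rev [Suc i..<k])"
proof -
  obtain m where m: "k = Suc m" "i \<le> m"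
    using assms(3) by (cases k) auto
  \<comment> \<open>No entry exceeds \<open>m\<close>, so \<open>m\<close> is appended; the entries
    that \<open>insort\<close> would leave to its right are copies of \<open>m\<close>, so the
    result is the same.\<close>
  have "row_insert m r = (insort m r, None)"
    using assms(1,2) unfolding m(1)
    by (induction r) (auto simp: insort_Cons dest: le_antisym)
  then show ?thesis
    using row_inserts_decreasing_insort[OF assms(1) m(2)] assms(2) m
    by (simp add: insort_Cons)
qed

text \<open>Every letter finds a larger entry to bump: the first one by assumption, each later one
  because its predecessor has just entered the row.\<close>

lemma length_row_inserts_decreasing:
  "\<exists>y\<in>set r. k \<le> y \<Longrightarrow> length (fst (row_inserts (rev [i..<k]) r)) = length r"
proof (induction k arbitrary: r)
  case (Suc k)
  show ?case
  proof (cases "i \<le> k")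
    case True
    from Suc.prems have "\<exists>y\<in>set r. k < y" by (simp add: Suc_le_eq)
    then obtain r' z where
      "row_insert k r = (r', Some z)" "length r' = length r" "k \<in> set r'"
      by (rule row_insert_bumping)
    moreover from this have "length (fst (row_inserts (rev [i..<k]) r')) = length r'"
      by (intro Suc.IH) auto
    ultimately show ?thesis using True by (auto split: prod.splits)
  qed simp
qed simp

text \<open>The bound grows by one per row, which reflects the strict increase down the
  columns.\<close>

fun rows_above :: "nat \<Rightarrow> nat list list \<Rightarrow> bool" where
  "rows_above i [] \<longleftrightarrow> True"
| "rows_above i (r # rs) \<longleftrightarrow> sorted r \<and> (\<forall>x\<in>set r. i \<le> x) \<and> rows_above (Suc i) rs"

lemma rows_above_tableau_insert:
  "rows_above i T \<Longrightarrow> i \<le> x \<Longrightarrow> rows_above i (tableau_insert x T)"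
proof (induction x T arbitrary: i rule: tableau_insert.induct)
  case (2 x r rs)
  obtain r' b where r': "row_insert x r = (r', b)" by fastforce
  with row_insert_sorted[OF r'] 2 show ?case
    by (cases b) (auto dest!: row_insert_bumped_gt)
qed simp

lemma rows_above_fold:
  "rows_above i T \<Longrightarrow> \<forall>x\<in>set w. i \<le> x \<Longrightarrow> rows_above i (fold tableau_insert w T)"
  by (induction w arbitrary: T) (auto simp: rows_above_tableau_insert)

fun add_column :: "nat \<Rightarrow> nat \<Rightarrow> nat list list \<Rightarrow> nat list list" where
  "add_column i 0 T = T"
| "add_column i (Suc n) [] = [i] # add_column (Suc i) n []"
| "add_column i (Suc n) (r # rs) = (i # r) # add_column (Suc i) n rs"

text \<open>The letter passes the new entry \<open>i\<close> since it is at least \<open>i\<close>;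
  a letter that it bumps is larger, hence at least \<open>Suc i\<close>, and passes the next new
  entry too.\<close>

lemma tableau_insert_add_column:
  "i \<le> x \<Longrightarrow> tableau_insert x (add_column i n T) = add_column i n (tableau_insert x T)"
proof (induction i n T arbitrary: x rule: add_column.induct)
  case (2 i n)
  then show ?case by simp
next
  case (3 i n r rs)
  obtain r' b where r': "row_insert x r = (r', b)" by fastforce
  with 3 show ?case
    by (cases b) (auto dest!: row_insert_bumped_gt)
qed simp

lemma fold_add_column:
  "\<forall>x\<in>set w. i \<le> x \<Longrightarrow>
    fold tableau_insert w (add_column i n T) = add_column i n (fold tableau_insert w T)"
  by (induction w arbitrary: T) (auto simp: tableau_insert_add_column)

text \<open>Moving down a row turns \<open>i\<close> and \<open>Suc n\<close> into
  \<open>Suc i\<close> and \<open>n\<close>, so the upper bound \<open>i + Suc n\<close> is the same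
  for all rows.\<close>

lemma fold_decreasing_eq_add_column_iff:
  "rows_above i T \<Longrightarrow>
    fold tableau_insert (rev [i..<i + n]) T = add_column i n T \<longleftrightarrow>
    (\<forall>r\<in>set (take n T). \<forall>x\<in>set r. x < i + n)"
proof (induction i n T rule: add_column.induct)
  case (1 i T)
  then show ?case by simp
next
  case (2 i n)
  \<comment> \<open>Insertion does not distinguish the empty tableau from a single empty row.\<close>
  have "fold tableau_insert (rev [i..<i + Suc n]) [] =
      fold tableau_insert (rev [i..<i + Suc n]) [[]]"
    by simp
  also have "\<dots> = [i] # fold tableau_insert (rev [Suc i..<i + Suc n]) []"
    by (intro fold_tableau_insert_Cons row_inserts_decreasing_bounded) auto
  finally show ?case using 2 by simp
next
  case (3 i n r rs)
  show ?case
  proof (cases "\<forall>x\<in>set r. x < i + Suc n")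
    case True
    then have "row_inserts (rev [i..<i + Suc n]) r = (i # r, rev [Suc i..<i + Suc n])"
      using 3(2) by (intro row_inserts_decreasing_bounded) auto
    from fold_tableau_insert_Cons[OF this, of rs] 3 True show ?thesis
      by (simp del: upt_Suc)
  next
    case False
    then have "length (fst (row_inserts (rev [i..<i + Suc n]) r)) = length r"
      by (intro length_row_inserts_decreasing) (auto simp: not_less)
    moreover obtain r' ys where
      r': "row_inserts (rev [i..<i + Suc n]) r = (r', ys)" by fastforce
    \<comment> \<open>The row has kept its length, whereas \<open>i # r\<close> is longer by
      one.\<close>
    ultimately have "r' \<noteq> i # r" by auto
    with fold_tableau_insert_Cons[OF r', of rs] False show ?thesis
      by (auto simp del: upt_Suc)
  qed
qed

lemma tableau_row_iff_take:
  "(\<forall>i\<in>{1..m}. \<forall>x\<in>set (tableau_row T i). Q x) \<longleftrightarrow> (\<forall>r\<in>set (take m T). \<forall>x\<in>set r. Q x)"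
proof
  assume rows: "\<forall>i\<in>{1..m}. \<forall>x\<in>set (tableau_row T i). Q x"
  show "\<forall>r\<in>set (take m T). \<forall>x\<in>set r. Q x"
  proof
    fix r assume "r \<in> set (take m T)"
    then obtain j where "j < m" "j < length T" "r = T ! j"
      by (auto simp: in_set_conv_nth)
    with rows[rule_format, of "Suc j"] show "\<forall>x\<in>set r. Q x"
      by (simp add: tableau_row_def)
  qed
next
  assume take: "\<forall>r\<in>set (take m T). \<forall>x\<in>set r. Q x"
  have "T ! (i - 1) \<in> set (take m T)" if "1 \<le> i" "i \<le> m" "i \<le> length T" for i
    unfolding in_set_conv_nth using that by (intro exI[of _ "i - 1"]) auto
  with take show "\<forall>i\<in>{1..m}. \<forall>x\<in>set (tableau_row T i). Q x"
    by (auto simp: tableau_row_def)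
qed

theorem theorem4p3:
  fixes m :: nat and u w :: "nat list"
  assumes "m \<ge> 1"
    and "u = decreasing_word m"
    and "\<forall>x\<in>set w. x \<ge> 1"
  shows "u @ w \<equiv>\<^sub>K w @ u \<longleftrightarrow>
    (\<forall>i\<in>{1..m}. \<forall>x\<in>set (tableau_row (insertion_tableau w) i). x \<le> m)"
proof -
  define T where "T = insertion_tableau w"
  have u: "u = rev [1..<1 + m]"
    using assms(2) by (simp add: decreasing_word_def)
  have "rows_above 1 T"
    using rows_above_fold[of 1 "[]" w] assms(3) by (simp add: T_def insertion_tableau_def)
  from fold_decreasing_eq_add_column_iff[OF this, of m]
  have wu: "insertion_tableau (w @ u) = add_column 1 m T \<longleftrightarrow>
      (\<forall>r\<in>set (take m T). \<forall>x\<in>set r. x \<le> m)"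
    by (simp add: u T_def insertion_tableau_def less_Suc_eq_le del: upt_Suc)
  \<comment> \<open>For the empty tableau the condition on the entries is vacuous.\<close>
  have "fold tableau_insert u [] = add_column 1 m []"
    using fold_decreasing_eq_add_column_iff[of 1 "[]" m] u by simp
  then have "insertion_tableau (u @ w) = add_column 1 m T"
    using fold_add_column[of w 1 m "[]"] assms(3) by (simp add: T_def insertion_tableau_def)
  with wu show ?thesis
    unfolding knuth_equiv_def tableau_row_iff_take T_def by auto
qed

end
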